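(* Let $n,r,s,p,n_1,\dots,n_p$ be positive integers such that $n\ge 2$, $s\ge r$, $p\ge 3$ and $n_p\ge\dots\ge n_1\ge 1$. Then: (i) $eqdim(K_n)=1$; (ii) $eqdim(K_{r,s})=r$; (iii) $eqdim(K_2(r,s))=r$; (iv) $eqdim(K_{n_1,\dots,n_p})=\min\{n_1,3\}$.
   Context: $d(x,y)$ denotes the graph distance. A set $S\subseteq V(G)$ of vertices of a connected graph $G$ is a distance-equalizer set of $G$ if for every two distinct vertices $x,y\in V(G)\setminus S$ there is $w\in S$ with $d(x,w)=d(y,w)$. The equidistant dimension $eqdim(G)$ is the minimum cardinality of a distance-equalizer set of $G$. $K_n$ is the complete graph of order $n$; $K_{r,s}$ is the complete bipartite graph with partite sets of sizes $r$ and $s$; $K_{n_1,\dots,n_p}$ is the complete $p$-partite graph with pairwise disjoint partite sets of sizes $n_1,\dots,n_p$, two vertices being adjacent if and only if they lie in different partite sets. The bistar $K_2(r,s)$ is the graph obtained from two disjoint stars $K_{1,r-1}$ and $K_{1,s-1}$ by adding an edge joining their centers (so it has $r+s$ vertices: two adjacent centers, one with $r-1$ pendant leaves and the other with $s-1$ pendant leaves). *)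

theory Defs
  imports "Graph_Theory.Graph_Theory" "HOL-Library.Disjoint_Sets"
begin

text \<open>
  Finite simple graphs are the symmetric digraphs of the locale \<^locale>\<open>graph\<close>. As for the
  library's \<^const>\<open>complete_digraph\<close> and \<^const>\<open>complete_bipartite_digraph\<close>, the named
  families below are predicates that describe a graph up to isomorphism.
\<close>

text \<open>The number of arcs of a shortest walk; \<open>\<infinity>\<close> if there is none.\<close>

definition graph_dist :: "('a, 'b) pre_digraph \<Rightarrow> 'a \<Rightarrow> 'a \<Rightarrow> ereal" where
  "graph_dist G u v = wf_digraph.\<mu> G (\<lambda>_. 1) u v"

definition distance_equalizer_set :: "('a, 'b) pre_digraph \<Rightarrow> 'a set \<Rightarrow> bool" where
  "distance_equalizer_set G S \<longleftrightarrow>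
     graph G \<and> Digraph_Component.connected G \<and> S \<subseteq> verts G \<and>
     (\<forall>x \<in> verts G - S. \<forall>y \<in> verts G - S. x \<noteq> y \<longrightarrow>
        (\<exists>w \<in> S. graph_dist G x w = graph_dist G y w))"

text \<open>
  The minimum exists for every connected graph, because the set of all vertices is a
  distance-equalizer set.
\<close>

definition eqdim :: "('a, 'b) pre_digraph \<Rightarrow> nat" where
  "eqdim G = (LEAST k. \<exists>S. distance_equalizer_set G S \<and> card S = k)"

text \<open>
  The centers are \<open>a\<close> and \<open>b\<close>, with sets of leaves \<open>A\<close> and \<open>B\<close>. Writing \<open>card A + 1 = r\<close>
  avoids truncated subtraction.
\<close>

definition bistar :: "nat \<Rightarrow> nat \<Rightarrow> ('a, 'b) pre_digraph \<Rightarrow> bool" where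
  "bistar r s G \<longleftrightarrow> graph G \<and>
     (\<exists>a b A B. a \<notin> A \<and> b \<notin> B \<and> insert a A \<inter> insert b B = {} \<and>
        card A + 1 = r \<and> card B + 1 = s \<and>
        verts G = insert a A \<union> insert b B \<and>
        arcs_ends G = ({a} \<times> A \<union> A \<times> {a}) \<union> ({b} \<times> B \<union> B \<times> {b}) \<union> {(a, b), (b, a)})"

definition complete_multipartite_digraph ::
    "nat \<Rightarrow> (nat \<Rightarrow> nat) \<Rightarrow> ('a, 'b) pre_digraph \<Rightarrow> bool" where
  "complete_multipartite_digraph p ns G \<longleftrightarrow> graph G \<and>
     (\<exists>V. verts G = (\<Union>i\<in>{1..p}. V i) \<and> disjoint_family_on V {1..p} \<and>
        (\<forall>i\<in>{1..p}. card (V i) = ns i) \<and>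
        arcs_ends G = {(u, v). \<exists>i\<in>{1..p}. \<exists>j\<in>{1..p}. i \<noteq> j \<and> u \<in> V i \<and> v \<in> V j})"

end

theory Submission
  imports Defs
begin

text \<open>
  Only two facts about distances are needed: distance one means adjacency, and in a bipartite graph
  the parity of the distance tells whether two vertices lie on the same side.

  Complete and complete multipartite graphs are so dense that a vertex of the set which equalizes
  a pair outside it can be taken adjacent to both, which gives the upper bounds (one vertex of
  \<open>K\<^sub>n\<close>, all of the first part, or three vertices from three parts). For the lower bound in the
  multipartite case, a set of at most two vertices meets at most two parts; if it contains no part,
  then outside vertices \<open>x\<close> and \<open>y\<close> of two parts that cover the set are never equalized, because
  every vertex of the set is adjacent to exactly one of them.

  Both \<open>K\<^sub>r\<^sub>,\<^sub>s\<close> and the bistar are bipartite with sides of sizes \<open>r \<le> s\<close>, and both have a vertex of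
  the smaller side that is adjacent to the whole larger side. For the bistar these
  sides are not its two stars: each side consists of one center together with the leaves of the
  other. In any such graph the equidistant dimension is the size of the smaller side. That side
  is a distance-equalizer set thanks to its dominating vertex. Conversely, a
  distance-equalizer set contains a whole side, since by parity no vertex is at equal distance from
  two vertices on opposite sides (lemma \<open>eqdim_bipartite\<close>).
\<close>

section \<open>Distances in a graph\<close>

lemma (in graph) graph_dist_le_length:
  assumes "awalk u p v"
  shows "graph_dist G u v \<le> real (length p)"
proof -
  have "awalk_cost (\<lambda>_. 1) p = real (length p)"
    by (simp add: awalk_cost_def sum_list_triv)
  then show ?thesis
    using min_cost_le_walk_cost[OF assms, of "\<lambda>_. 1"] by (simp add: graph_dist_def)
qed

lemma (in graph) graph_dist_attained:
  assumes "u \<rightarrow>\<^sup>* v"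
  obtains p where "awalk u p v" "graph_dist G u v = real (length p)"
proof -
  obtain p where "apath u p v" "\<mu> (\<lambda>_. 1) u v = awalk_cost (\<lambda>_. 1) p"
    using min_cost_awalk[OF assms, of "\<lambda>_. 1"] by auto
  then show thesis
    by (intro that[of p]) (simp_all add: apath_def graph_dist_def awalk_cost_def sum_list_triv)
qed

lemma (in graph) graph_dist_eq_1_iff:
  assumes "u \<rightarrow>\<^sup>* v"
  shows "graph_dist G u v = 1 \<longleftrightarrow> u \<rightarrow> v"
proof
  obtain p where p: "awalk u p v" "graph_dist G u v = real (length p)"
    using graph_dist_attained[OF assms] .
  {
    assume "graph_dist G u v = 1"
    then have "length p = 1"
      using p(2) by simp
    then obtain e where "p = [e]"
      by (auto simp: length_Suc_conv)
    then show "u \<rightarrow> v"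
      using p(1) in_arcs_imp_in_arcs_ends by (auto simp: awalk_simps)
  next
    assume adj: "u \<rightarrow> v"
    then obtain e where "e \<in> arcs G" "tail G e = u" "head G e = v"
      by auto
    then have "graph_dist G u v \<le> 1"
      using graph_dist_le_length[OF arc_implies_awalk, of e] by (simp add: one_ereal_def)
    then have "length p \<le> 1"
      using p(2) by simp
    moreover have "p \<noteq> []"
      using p(1) adj adj_not_same by (auto simp: awalk_Nil_iff)
    ultimately have "length p = 1"
      by (cases p) auto
    then show "graph_dist G u v = 1"
      using p(2) by simp
  }
qed

text \<open>Each arc of a bipartite graph changes the side.\<close>

lemma (in wf_digraph) even_length_awalk_iff_same_side:
  assumes "\<And>x y. x \<rightarrow> y \<Longrightarrow> x \<in> U \<longleftrightarrow> y \<notin> U"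
    and "awalk u p v"
  shows "even (length p) \<longleftrightarrow> (u \<in> U \<longleftrightarrow> v \<in> U)"
  using assms(2)
proof (induction p arbitrary: u)
  case Nil
  then show ?case by (auto simp: awalk_Nil_iff)
next
  case (Cons e p)
  then have "u \<rightarrow> head G e" and "awalk (head G e) p v"
    using in_arcs_imp_in_arcs_ends by (auto simp: awalk_Cons_iff)
  then show ?case
    using Cons.IH assms(1) by auto
qed

lemma (in graph) equal_dist_imp_same_side:
  assumes bip: "\<And>x y. x \<rightarrow> y \<Longrightarrow> x \<in> U \<longleftrightarrow> y \<notin> U"
    and "x \<rightarrow>\<^sup>* w" "y \<rightarrow>\<^sup>* w" and eq: "graph_dist G x w = graph_dist G y w"
  shows "x \<in> U \<longleftrightarrow> y \<in> U"
proof -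
  obtain p where p: "awalk x p w" "graph_dist G x w = real (length p)"
    using graph_dist_attained[OF assms(2)] .
  obtain q where q: "awalk y q w" "graph_dist G y w = real (length q)"
    using graph_dist_attained[OF assms(3)] .
  have "length p = length q"
    using eq p(2) q(2) by simp
  then show ?thesis
    using even_length_awalk_iff_same_side[OF bip p(1)]
      even_length_awalk_iff_same_side[OF bip q(1)] by auto
qed

section \<open>Distance-equalizer sets\<close>

lemma (in graph) reachable_if_connected:
  assumes "connected G" "u \<in> verts G" "v \<in> verts G"
  shows "u \<rightarrow>\<^sup>* v"
  using symmetric_connected_imp_strongly_connected[OF sym_arcs assms(1)] assms(2,3) by auto

text \<open>All the graphs considered here are connected because some vertex reaches every other
  one in at most two steps.\<close>

lemma (in graph) connected_if_radius_le_2: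
  assumes "c \<in> verts G"
    and "\<And>v. v \<in> verts G \<Longrightarrow> v = c \<or> c \<rightarrow> v \<or> (\<exists>u. c \<rightarrow> u \<and> u \<rightarrow> v)"
  shows "connected G"
proof -
  have c: "c \<rightarrow>\<^sup>* v" if "v \<in> verts G" for v
    using assms(2)[OF that] assms(1) reachable_adj_trans by blast
  have "u \<rightarrow>\<^sup>*\<^bsub>mk_symmetric G\<^esub> v" if "u \<in> verts G" "v \<in> verts G" for u v
    using symmetric_reachable'[OF c[OF that(1)]] c[OF that(2)] reachable_trans
    by (simp only: reachable_mk_symmetric_eq[OF sym_arcs])
  then show ?thesis
    using assms(1) by (intro connectedI) auto
qed

lemma eqdim_eqI:
  assumes "distance_equalizer_set G S" "card S = k"
    and "\<And>T. distance_equalizer_set G T \<Longrightarrow> k \<le> card T"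
  shows "eqdim G = k"
  unfolding eqdim_def using assms by (intro Least_equality) auto

lemma (in graph) distance_equalizer_setI_common_neighbour:
  assumes "connected G" "S \<subseteq> verts G"
    and "\<And>x y. \<lbrakk>x \<in> verts G - S; y \<in> verts G - S; x \<noteq> y\<rbrakk> \<Longrightarrow> \<exists>w\<in>S. x \<rightarrow> w \<and> y \<rightarrow> w"
  shows "distance_equalizer_set G S"
proof -
  have "graph_dist G x w = graph_dist G y w" if "x \<rightarrow> w" "y \<rightarrow> w" for x y w
    using that graph_dist_eq_1_iff by (metis reachable_adjI)
  then show ?thesis
    unfolding distance_equalizer_set_def using assms graph_axioms by (auto; meson DiffI)
qed

section \<open>Complete graphs\<close>

lemma eqdim_complete:
  assumes K: "complete_digraph n G" and "n \<ge> 2"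
  shows "eqdim G = 1"
proof -
  interpret graph G using K by (simp add: complete_digraph_def)
  have V: "card (verts G) = n"
    and adj: "\<And>u v. u \<rightarrow>\<^bsub>G\<^esub> v \<longleftrightarrow> u \<in> verts G \<and> v \<in> verts G \<and> u \<noteq> v"
    using K by (auto simp: complete_digraph_def)
  obtain a b where ab: "a \<in> verts G" "b \<in> verts G" "a \<noteq> b"
    using V \<open>n \<ge> 2\<close> by (metis card_le_Suc0_iff_eq finite_verts not_less_eq_eq numeral_2_eq_2)
  have "connected G"
    using ab(1) adj by (intro connected_if_radius_le_2[of a]) auto
  then have "distance_equalizer_set G {a}"
    using ab(1) adj by (intro distance_equalizer_setI_common_neighbour) auto
  then show ?thesis
  proof (rule eqdim_eqI)
    fix T assume T: "distance_equalizer_set G T"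
    then have "T \<noteq> {}"
      using ab by (auto simp: distance_equalizer_set_def)
    moreover have "finite T"
      using T finite_verts by (auto simp: distance_equalizer_set_def intro: finite_subset)
    ultimately show "1 \<le> card T"
      by (simp add: Suc_le_eq card_gt_0_iff)
  qed simp
qed

section \<open>Bipartite graphs with a dominating vertex\<close>

lemma (in graph) distance_equalizer_set_contains_side:
  assumes "verts G = U \<union> V" "U \<inter> V = {}"
    and bip: "\<And>x y. x \<rightarrow> y \<Longrightarrow> x \<in> U \<longleftrightarrow> y \<notin> U"
    and S: "distance_equalizer_set G S"
  shows "U \<subseteq> S \<or> V \<subseteq> S"
proof (rule ccontr)
  assume "\<not> ?thesis"
  then obtain x y where xy: "x \<in> U" "x \<notin> S" "y \<in> V" "y \<notin> S"
    by blast
  then have "x \<noteq> y" "x \<in> verts G" "y \<in> verts G"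
    using assms(1,2) by auto
  then obtain w where w: "w \<in> S" "graph_dist G x w = graph_dist G y w"
    using S xy unfolding distance_equalizer_set_def by (meson DiffI)
  have "w \<in> verts G" "connected G"
    using S w(1) by (auto simp: distance_equalizer_set_def)
  then have "x \<in> U \<longleftrightarrow> y \<in> U"
    using \<open>x \<in> verts G\<close> \<open>y \<in> verts G\<close> w(2)
    by (intro equal_dist_imp_same_side[OF bip]) (auto intro: reachable_if_connected)
  then show False
    using xy assms(2) by auto
qed

text \<open>
  The vertex \<open>c\<close> makes the side \<open>U\<close> a distance-equalizer set, being at distance one from every
  vertex outside it. Vertices of \<open>U\<close> without neighbours are excluded to make the graph connected:
  every vertex of \<open>U\<close> is reached from \<open>c\<close> through \<open>V\<close>.
\<close>

lemma (in graph) eqdim_bipartite: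
  assumes V: "verts G = U \<union> V" "U \<inter> V = {}" "card U \<le> card V"
    and bip: "\<And>x y. x \<rightarrow> y \<Longrightarrow> x \<in> U \<longleftrightarrow> y \<notin> U"
    and c: "c \<in> U" "\<And>v. v \<in> V \<Longrightarrow> c \<rightarrow> v"
    and U: "\<And>u. u \<in> U \<Longrightarrow> \<exists>v. v \<rightarrow> u"
  shows "eqdim G = card U"
proof -
  have U_adj: "\<exists>v\<in>V. v \<rightarrow> u" if u: "u \<in> U" for u
  proof -
    obtain v where "v \<rightarrow> u" using U[OF u] by auto
    moreover have "v \<in> V" using bip[OF calculation] adj_in_verts[OF calculation] u V(1) by auto
    ultimately show ?thesis by blast
  qed
  have conn: "connected G"
  proof (rule connected_if_radius_le_2)
    show "c \<in> verts G" using c(1) V(1) by simp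
    show "v = c \<or> c \<rightarrow> v \<or> (\<exists>u. c \<rightarrow> u \<and> u \<rightarrow> v)" if "v \<in> verts G" for v
      using that V(1) c(2) U_adj by blast
  qed
  have "distance_equalizer_set G U"
  proof (rule distance_equalizer_setI_common_neighbour[OF conn])
    fix x y assume "x \<in> verts G - U" "y \<in> verts G - U"
    then show "\<exists>w\<in>U. x \<rightarrow> w \<and> y \<rightarrow> w"
      using V(1) c arcs_ends_symmetric[OF sym_arcs] by blast
  qed (use V(1) in auto)
  then show ?thesis
  proof (rule eqdim_eqI)
    fix T assume T: "distance_equalizer_set G T"
    have "finite T"
      using T finite_verts by (auto simp: distance_equalizer_set_def intro: finite_subset)
    then show "card U \<le> card T"
      using distance_equalizer_set_contains_side[OF V(1,2) bip T] V(3)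
      by (meson card_mono order_trans)
  qed simp
qed

lemma eqdim_complete_bipartite:
  assumes K: "complete_bipartite_digraph r s G" and "1 \<le> r" "r \<le> s"
  shows "eqdim G = r"
proof -
  interpret graph G using K by (simp add: complete_bipartite_digraph_def)
  obtain U V where UV: "verts G = U \<union> V" "U \<inter> V = {}" "card U = r" "card V = s"
    "arcs_ends G = U \<times> V \<union> V \<times> U"
    using K by (auto simp: complete_bipartite_digraph_def)
  obtain u v where "u \<in> U" "v \<in> V"
    using UV(3,4) assms(2,3) by (metis card.empty ex_in_conv le_zero_eq not_one_le_zero)
  then have "eqdim G = card U"
    using UV assms(3) by (intro eqdim_bipartite[of U V u]) auto
  then show ?thesis using UV(3) by simp
qed

lemma eqdim_bistar:
  assumes K: "bistar r s G" and "r \<le> s"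
  shows "eqdim G = r"
proof -
  interpret graph G using K by (simp add: bistar_def)
  obtain a b A B where ab: "a \<notin> A" "b \<notin> B" "insert a A \<inter> insert b B = {}"
      "card A + 1 = r" "card B + 1 = s" "verts G = insert a A \<union> insert b B"
    and ends: "arcs_ends G =
      ({a} \<times> A \<union> A \<times> {a}) \<union> ({b} \<times> B \<union> B \<times> {b}) \<union> {(a, b), (b, a)}"
    using K unfolding bistar_def by blast
  have "finite A" "finite B"
    using finite_verts ab(6) by simp_all
  then have card: "card (insert b A) = r" "card (insert a B) = s"
    using ab by auto
  have "eqdim G = card (insert b A)"
  proof (rule eqdim_bipartite[of _ "insert a B" b])
    show "x \<in> insert b A \<longleftrightarrow> y \<notin> insert b A" if "x \<rightarrow>\<^bsub>G\<^esub> y" for x y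
      using that ab unfolding ends by auto
    show "b \<rightarrow>\<^bsub>G\<^esub> v" if "v \<in> insert a B" for v
      using that unfolding ends by auto
    show "\<exists>v. v \<rightarrow>\<^bsub>G\<^esub> u" if "u \<in> insert b A" for u
      using that unfolding ends by auto
  qed (use ab card \<open>r \<le> s\<close> in auto)
  then show ?thesis using card by simp
qed

section \<open>Complete multipartite graphs\<close>

lemma card_le_2_subset_pair:
  assumes "card I \<le> 2" "I \<subseteq> J" "2 \<le> card J"
  obtains i j where "i \<in> J" "j \<in> J" "i \<noteq> j" "I \<subseteq> {i, j}"
proof -
  have "finite J" using assms(3) card.infinite by fastforce
  then obtain K where "I \<subseteq> K" "K \<subseteq> J" "card K = 2"
    using exists_subset_between[OF assms(1,3,2)] by auto
  then show thesis using that by (auto simp: card_2_iff)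
qed

lemma eqdim_complete_multipartite:
  assumes K: "complete_multipartite_digraph p ns G"
    and p: "3 \<le> p" and pos: "\<forall>i\<in>{1..p}. 1 \<le> ns i" and mono: "mono_on {1..p} ns"
  shows "eqdim G = min (ns 1) 3"
proof -
  interpret graph G using K by (simp add: complete_multipartite_digraph_def)
  obtain V where verts: "verts G = (\<Union>i\<in>{1..p}. V i)" and disj: "disjoint_family_on V {1..p}"
    and card: "\<forall>i\<in>{1..p}. card (V i) = ns i"
    and ends: "arcs_ends G = {(u, v). \<exists>i\<in>{1..p}. \<exists>j\<in>{1..p}. i \<noteq> j \<and> u \<in> V i \<and> v \<in> V j}"
    using K unfolding complete_multipartite_digraph_def by blast
  have same: "i = j" if "i \<in> {1..p}" "j \<in> {1..p}" "u \<in> V i" "u \<in> V j" for i j u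
    using disj that unfolding disjoint_family_on_def by blast
  have adj: "u \<rightarrow>\<^bsub>G\<^esub> v \<longleftrightarrow> i \<noteq> j" if "i \<in> {1..p}" "j \<in> {1..p}" "u \<in> V i" "v \<in> V j" for i j u v
    using that same unfolding ends by blast
  have fin: "finite (V i)" if "i \<in> {1..p}" for i
    using that finite_verts unfolding verts by auto
  have ns1: "ns 1 \<le> ns i" if "i \<in> {1..p}" for i
    using mono that p by (auto simp: mono_on_def)
  obtain f where f: "\<And>i. i \<in> {1..p} \<Longrightarrow> f i \<in> V i"
  proof -
    have "V i \<noteq> {}" if "i \<in> {1..p}" for i
      using that card pos by fastforce
    then have "\<forall>i\<in>{1..p}. \<exists>v. v \<in> V i" by blast
    then show thesis using that by (metis bchoice)
  qed
  have I: "1 \<in> {1..p}" "2 \<in> {1..p}" "3 \<in> {1..p}"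
    using p by auto
  have conn: "connected G"
  proof (rule connected_if_radius_le_2)
    show "f 1 \<in> verts G" using f I unfolding verts by blast
    fix v assume "v \<in> verts G"
    then obtain j where j: "j \<in> {1..p}" "v \<in> V j" unfolding verts by auto
    show "v = f 1 \<or> f 1 \<rightarrow>\<^bsub>G\<^esub> v \<or> (\<exists>u. f 1 \<rightarrow>\<^bsub>G\<^esub> u \<and> u \<rightarrow>\<^bsub>G\<^esub> v)"
    proof (cases "j = 1")
      case True
      then have "f 1 \<rightarrow>\<^bsub>G\<^esub> f 2" "f 2 \<rightarrow>\<^bsub>G\<^esub> v"
        using adj[OF I(1,2) f[OF I(1)] f[OF I(2)]] adj[OF I(2) j(1) f[OF I(2)] j(2)] by auto
      then show ?thesis by blast
    qed (use adj[OF I(1) j(1) f[OF I(1)] j(2)] in simp)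
  qed

  \<comment> \<open>Every vertex of the first part is adjacent to all the other parts. Three vertices from different
    parts do as well, because two vertices outside lie in at most two parts and so the third
    part yields a common neighbour.\<close>
  have "\<exists>S. distance_equalizer_set G S \<and> card S = min (ns 1) 3"
  proof (cases "ns 1 \<le> 3")
    case True
    have "distance_equalizer_set G (V 1)"
    proof (rule distance_equalizer_setI_common_neighbour[OF conn])
      show "V 1 \<subseteq> verts G" using I verts by blast
      fix x y assume xy: "x \<in> verts G - V 1" "y \<in> verts G - V 1"
      have "z \<rightarrow>\<^bsub>G\<^esub> f 1" if z: "z \<in> verts G - V 1" for z
      proof -
        obtain i where i: "i \<in> {1..p}" "z \<in> V i" using z unfolding verts by auto
        then have "i \<noteq> 1" using z by auto
        then show ?thesis using adj[OF i(1) I(1) i(2) f[OF I(1)]] by simp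
      qed
      then show "\<exists>w\<in>V 1. x \<rightarrow>\<^bsub>G\<^esub> w \<and> y \<rightarrow>\<^bsub>G\<^esub> w"
        using xy f[OF I(1)] by blast
    qed
    then show ?thesis using card I True by (intro exI[of _ "V 1"]) auto
  next
    case False
    have "distance_equalizer_set G (f ` {1, 2, 3})"
    proof (rule distance_equalizer_setI_common_neighbour[OF conn])
      show "f ` {1, 2, 3} \<subseteq> verts G" using f I unfolding verts by blast
      fix x y assume "x \<in> verts G - f ` {1, 2, 3}" "y \<in> verts G - f ` {1, 2, 3}"
      then obtain i j where ij: "i \<in> {1..p}" "x \<in> V i" "j \<in> {1..p}" "y \<in> V j"
        unfolding verts by auto
      have "(1 \<noteq> i \<and> 1 \<noteq> j) \<or> (2 \<noteq> i \<and> 2 \<noteq> j) \<or> (3 \<noteq> i \<and> 3 \<noteq> j)"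
        by presburger
      then obtain k where k: "k \<in> {1, 2, 3}" "k \<noteq> i" "k \<noteq> j"
        by blast
      then have "k \<in> {1..p}" using I by auto
      then have "x \<rightarrow>\<^bsub>G\<^esub> f k" "y \<rightarrow>\<^bsub>G\<^esub> f k"
        using adj[OF ij(1) _ ij(2) f] adj[OF ij(3) _ ij(4) f] k(2,3) by auto
      then show "\<exists>w\<in>f ` {1, 2, 3}. x \<rightarrow>\<^bsub>G\<^esub> w \<and> y \<rightarrow>\<^bsub>G\<^esub> w"
        using k(1) by blast
    qed
    moreover have "f 1 \<noteq> f 2" "f 1 \<noteq> f 3" "f 2 \<noteq> f 3"
      using same[OF I(1,2)] same[OF I(1,3)] same[OF I(2,3)] f[OF I(1)] f[OF I(2)] f[OF I(3)]
      by fastforce+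
    ultimately show ?thesis using False by (intro exI[of _ "f ` {1, 2, 3}"]) auto
  qed
  then obtain S where "distance_equalizer_set G S" "card S = min (ns 1) 3"
    by blast
  then show ?thesis
  proof (rule eqdim_eqI)
    fix T assume T: "distance_equalizer_set G T"
    then have sub: "T \<subseteq> verts G" by (simp add: distance_equalizer_set_def)
    then have fT: "finite T" using finite_verts finite_subset by blast
    show "min (ns 1) 3 \<le> card T"
    proof (rule ccontr)
      assume "\<not> min (ns 1) 3 \<le> card T"
      then have small: "card T < ns 1" "card T \<le> 2" by auto
      obtain part where part: "\<And>w. w \<in> T \<Longrightarrow> part w \<in> {1..p} \<and> w \<in> V (part w)"
      proof -
        have "\<forall>w\<in>T. \<exists>i. i \<in> {1..p} \<and> w \<in> V i" using sub verts by blast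
        then show thesis using that by metis
      qed
      have "card (part ` T) \<le> 2" using small(2) card_image_le[OF fT, of part] by simp
      moreover have "part ` T \<subseteq> {1..p}" using part by blast
      ultimately obtain i j where ij: "i \<in> {1..p}" "j \<in> {1..p}" "i \<noteq> j" "part ` T \<subseteq> {i, j}"
        using p by (elim card_le_2_subset_pair) auto
      \<comment> \<open>The first part is a smallest one, so \<open>T\<close> is too small to contain any part.\<close>
      have "\<exists>x\<in>V k. x \<notin> T" if k: "k \<in> {1..p}" for k
      proof -
        have "card T < card (V k)" using small(1) ns1[OF k] card k by simp
        then show ?thesis using card_mono[OF fT, of "V k"] by auto
      qed
      then obtain x y where xy: "x \<in> V i" "x \<notin> T" "y \<in> V j" "y \<notin> T"
        using ij by meson
      then have xyG: "x \<in> verts G" "y \<in> verts G" "x \<noteq> y"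
        using ij same unfolding verts by blast+
      then obtain w where w: "w \<in> T" "graph_dist G x w = graph_dist G y w"
        using T xy unfolding distance_equalizer_set_def by (meson DiffI)
      have "w \<in> verts G" using w(1) sub by blast
      then have "x \<rightarrow>\<^bsub>G\<^esub> w \<longleftrightarrow> y \<rightarrow>\<^bsub>G\<^esub> w"
        using w(2) xyG graph_dist_eq_1_iff reachable_if_connected[OF conn] by metis
      moreover have "part w = i \<or> part w = j" using ij(4) w(1) by blast
      moreover have "x \<rightarrow>\<^bsub>G\<^esub> w \<longleftrightarrow> i \<noteq> part w" "y \<rightarrow>\<^bsub>G\<^esub> w \<longleftrightarrow> j \<noteq> part w"
        using adj[OF ij(1) _ xy(1)] adj[OF ij(2) _ xy(3)] part[OF w(1)] by auto
      ultimately show False using ij(3) by auto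
    qed
  qed
qed

theorem theorem9:
  fixes n r s p :: nat and ns :: "nat \<Rightarrow> nat"
  assumes "n \<ge> 2"
    and "r \<ge> 1" and "s \<ge> r"
    and "p \<ge> 3" and "\<forall>i\<in>{1..p}. ns i \<ge> 1" and "mono_on {1..p} ns"
  shows "(\<forall>G :: ('a, 'b) pre_digraph. complete_digraph n G \<longrightarrow> eqdim G = 1) \<and>
    (\<forall>G :: ('a, 'b) pre_digraph. complete_bipartite_digraph r s G \<longrightarrow> eqdim G = r) \<and>
    (\<forall>G :: ('a, 'b) pre_digraph. bistar r s G \<longrightarrow> eqdim G = r) \<and>
    (\<forall>G :: ('a, 'b) pre_digraph. complete_multipartite_digraph p ns G \<longrightarrow>
        eqdim G = min (ns 1) 3)"
  by (intro conjI allI impI; erule eqdim_complete eqdim_complete_bipartite eqdim_bistar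
      eqdim_complete_multipartite; fact)

end
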